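(* Let $\alpha>0$, and let $\phi(X)=\sum_{i,j}\Lambda(X_{ij})$ for $X\in\mathbb{R}^{m\times n}$, where $\Lambda:\mathbb{R}\to(-\infty,\infty]$ is given by $\Lambda(x)=-|1-2x|+1$ for $x\in[0,1]$ and $\Lambda(x)=\infty$ otherwise. Then the proximal operator of $\alpha\phi$ maps the matrix $X\in\mathbb{R}^{m\times n}$ to the matrix $\mathrm{prox}_{\alpha\phi}(X)=A\in[0,1]^{m\times n}$ defined by $A_{ji}=\mathrm{prox}_{\alpha\Lambda}(X_{ji})$, where for $x\in\mathbb{R}$ $$\mathrm{prox}_{\alpha\Lambda}(x)=\begin{cases}\max\{0,x-2\alpha\} & x\le 0.5,\\ \min\{1,x+2\alpha\} & x>0.5.\end{cases}$$
   Context: For a function $\psi:\mathbb{R}^{m\times n}\to(-\infty,\infty]$, a proximal mapping of $\psi$ is a function $\mathrm{prox}_\psi$ that returns, for each matrix $X$, a matrix satisfying $$\mathrm{prox}_\psi(X)\in\operatorname*{arg\,min}_{X^\star\in\mathbb{R}^{m\times n}}\left\{\tfrac12\|X-X^\star\|^2+\psi(X^\star)\right\},$$ where $\|\cdot\|$ is the Frobenius norm. The minimizer need not be unique. "The proximal operator maps $X$ to $A$" therefore means that $A$ belongs to this set of minimizers (with $\psi=\alpha\phi$). The same applies to the scalar function $\alpha\Lambda$ on $\mathbb{R}$ (the case $m=n=1$), where $\mathrm{prox}_{\alpha\Lambda}(x)\in\operatorname*{arg\,min}_{x^\star\in\mathbb{R}}\{\frac12(x-x^\star)^2+\alpha\Lambda(x^\star)\}$.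 *)

theory Defs
  imports "HOL-Analysis.Analysis"
begin

text \<open>The minimiser need not be unique, so the proximal mapping is set-valued: it collects all
  admissible values at a point. For matrices \<open>'a = real^'n^'m\<close>, whose norm is the
  Frobenius norm (see \<open>power2_norm_matrix\<close>); for scalars \<open>'a = real\<close>.\<close>

definition prox :: "('a::real_normed_vector \<Rightarrow> ereal) \<Rightarrow> 'a \<Rightarrow> 'a set" where
  "prox \<psi> X = {A. is_arg_min (\<lambda>Y. ereal (1/2 * (norm (X - Y))\<^sup>2) + \<psi> Y) (\<lambda>_. True) A}"

lemma power2_norm_matrix:
  fixes X :: "real^'n^'m"
  shows "(norm X)\<^sup>2 = (\<Sum>i\<in>UNIV. \<Sum>j\<in>UNIV. (X $ i $ j)\<^sup>2)"
  by (simp add: norm_vec_def L2_set_def sum_nonneg)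

definition Lambda :: "real \<Rightarrow> ereal" where
  "Lambda x = (if x \<in> {0..1} then ereal (- \<bar>1 - 2 * x\<bar> + 1) else \<infinity>)"

definition phi :: "real^'n^'m \<Rightarrow> ereal" where
  "phi X = (\<Sum>i\<in>UNIV. \<Sum>j\<in>UNIV. Lambda (X $ i $ j))"

text \<open>The case formula only; that it is a selection from \<open>prox\<close> of \<open>\<alpha>\<close> times
  \<open>Lambda\<close> is a claim to be proved. At \<open>x = 1/2\<close> there are two minimisers.\<close>

definition prox_Lambda :: "real \<Rightarrow> real \<Rightarrow> real" where
  "prox_Lambda \<alpha> x = (if x \<le> 1/2 then max 0 (x - 2 * \<alpha>) else min 1 (x + 2 * \<alpha>))"

end

(* The Frobenius norm and \<phi> are both sums over entries, so the matrix problem splits into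
   scalar ones. In the scalar problem the penalty is invariant under the reflection t \<mapsto> 1 - t,
   hence some minimiser lies on the same side of 1/2 as x; there the penalty is linear, and the
   objective is a quadratic whose vertex x \<mp> 2\<alpha> is clipped to [0,1]. *)

theory Submission
  imports Defs
begin

lemma mem_prox_iff:
  "A \<in> prox \<psi> X \<longleftrightarrow> (\<forall>Y. ereal (1/2 * (norm (X - A))\<^sup>2) + \<psi> A \<le> ereal (1/2 * (norm (X - Y))\<^sup>2) + \<psi> Y)"
  by (auto simp: prox_def is_arg_min_def not_less)

lemma Lambda_nonneg: "0 \<le> Lambda x"
  by (auto simp: Lambda_def)

lemma Lambda_reflect: "Lambda (1 - x) = Lambda x"
  by (auto simp: Lambda_def)

lemma prox_Lambda_mem_Icc:
  assumes "\<alpha> > 0"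
  shows "prox_Lambda \<alpha> x \<in> {0..1}"
  using assms by (auto simp: prox_Lambda_def)

text \<open>The quadratic has its vertex at \<open>x - c\<close>. If that is at most 0, the
  objective grows on the half-line from 0; otherwise completing the square gives the bound.\<close>

lemma clipped_vertex_minimises:
  fixes x t c :: real
  assumes "0 \<le> t"
  shows "1/2 * (x - max 0 (x - c))\<^sup>2 + c * max 0 (x - c) \<le> 1/2 * (x - t)\<^sup>2 + c * t"
proof (cases "x \<le> c")
  case True
  have "0 \<le> t * t" "0 \<le> (c - x) * t"
    using True assms by auto
  moreover have "1/2 * (x - t)\<^sup>2 + c * t = 1/2 * x\<^sup>2 + (t * t / 2 + (c - x) * t)"
    by (simp add: power2_eq_square field_simps)
  ultimately show ?thesis
    using True by simp
next
  case False
  \<comment> \<open>This square is exactly twice the right side minus the left side.\<close>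
  have "0 \<le> (t - (x - c))\<^sup>2"
    by simp
  then show ?thesis
    using False by (simp add: power2_eq_square algebra_simps)
qed

text \<open>Folding \<open>t\<close> at 1/2 to \<open>s\<close> keeps the penalty and, since
  \<open>x\<close> is at most 1/2, does not increase the distance to \<open>x\<close>. On the folded
  side the penalty is linear with slope \<open>2 * \<alpha>\<close>.\<close>

lemma prox_Lambda_le_half_minimises:
  fixes x t :: real
  assumes "\<alpha> > 0" "x \<le> 1/2" "0 \<le> t" "t \<le> 1"
  defines "p \<equiv> max 0 (x - 2 * \<alpha>)"
  shows "1/2 * (x - p)\<^sup>2 + \<alpha> * (1 - \<bar>1 - 2 * p\<bar>) \<le> 1/2 * (x - t)\<^sup>2 + \<alpha> * (1 - \<bar>1 - 2 * t\<bar>)"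
proof -
  define s where "s = min t (1 - t)"
  have "(x - s)\<^sup>2 \<le> (x - t)\<^sup>2"
  proof (cases "t \<le> 1/2")
    case False
    \<comment> \<open>The product equals
      \<open>(x - t)\<^sup>2 - (x - (1 - t))\<^sup>2\<close>.\<close>
    have "0 \<le> (2 * t - 1) * (1 - 2 * x)"
      using False assms by (intro mult_nonneg_nonneg) auto
    then show ?thesis
      using False by (simp add: s_def min_def power2_eq_square algebra_simps)
  qed (simp add: s_def min_def)
  moreover have "1 - \<bar>1 - 2 * t\<bar> = 2 * s" "1 - \<bar>1 - 2 * p\<bar> = 2 * p" "0 \<le> s"
    using assms by (auto simp: s_def p_def min_def max_def)
  ultimately show ?thesis
    using clipped_vertex_minimises[of s x "2 * \<alpha>"] by (simp add: p_def mult_ac)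
qed

lemma prox_Lambda_mem_prox:
  assumes "\<alpha> > 0"
  shows "prox_Lambda \<alpha> x \<in> prox (\<lambda>t. ereal \<alpha> * Lambda t) x"
proof -
  define F where "F = (\<lambda>x t. ereal (1/2 * (x - t)\<^sup>2) + ereal \<alpha> * Lambda t)"
  \<comment> \<open>Stated for every such point, so that it can be used at \<open>1 - x\<close> when
    \<open>x\<close> exceeds 1/2.\<close>
  have left: "F x (max 0 (x - 2 * \<alpha>)) \<le> F x t" if "x \<le> 1/2" for x t
  proof (cases "t \<in> {0..1}")
    case True
    then show ?thesis
      using prox_Lambda_le_half_minimises[of \<alpha> x t] that assms
      by (simp add: F_def Lambda_def)
  qed (use assms in \<open>auto simp: F_def Lambda_def\<close>)
  have reflect: "F (1 - x) (1 - t) = F x t" for x t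
    by (simp add: F_def Lambda_reflect power2_commute)
  have "F x (prox_Lambda \<alpha> x) \<le> F x t" for t
  proof (cases "x \<le> 1/2")
    case False
    \<comment> \<open>The upper case of the formula is the reflection of the lower case at
      \<open>1 - x\<close>.\<close>
    then have "prox_Lambda \<alpha> x = 1 - max 0 (1 - x - 2 * \<alpha>)"
      by (auto simp: prox_Lambda_def)
    then show ?thesis
      using left[of "1 - x" "1 - t"] False reflect[of x "prox_Lambda \<alpha> x"] reflect[of x t] by simp
  qed (use left in \<open>simp add: prox_Lambda_def\<close>)
  then show ?thesis
    by (simp add: mem_prox_iff F_def)
qed

lemma prox_objective_eq_sum:
  fixes X Y :: "real^'n^'m"
  assumes "\<alpha> > 0"
  shows "ereal (1/2 * (norm (X - Y))\<^sup>2) + ereal \<alpha> * phi Y =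
    (\<Sum>i\<in>UNIV. \<Sum>j\<in>UNIV. ereal (1/2 * (norm (X $ i $ j - Y $ i $ j))\<^sup>2) + ereal \<alpha> * Lambda (Y $ i $ j))"
proof -
  \<comment> \<open>Distributivity over sums in \<open>ereal\<close> is delicate at infinities; here
    it holds because all values of \<open>Lambda\<close> are nonnegative.\<close>
  have "ereal \<alpha> * phi Y = (\<Sum>i\<in>UNIV. \<Sum>j\<in>UNIV. ereal \<alpha> * Lambda (Y $ i $ j))"
    by (simp add: phi_def sum_ereal_right_distrib Lambda_nonneg sum_nonneg)
  moreover have "ereal (1/2 * (norm (X - Y))\<^sup>2) =
      (\<Sum>i\<in>UNIV. \<Sum>j\<in>UNIV. ereal (1/2 * (norm (X $ i $ j - Y $ i $ j))\<^sup>2))"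
    by (simp add: power2_norm_matrix sum_distrib_left sum_divide_distrib)
  ultimately show ?thesis
    by (simp only: sum.distrib)
qed

theorem theorem1:
  fixes \<alpha> :: real and X A :: "real^'n^'m"
  assumes "\<alpha> > 0"
    and "\<And>j i. A $ j $ i = prox_Lambda \<alpha> (X $ j $ i)"
  shows "(\<forall>x. prox_Lambda \<alpha> x \<in> prox (\<lambda>t. ereal \<alpha> * Lambda t) x)
    \<and> A \<in> prox (\<lambda>Y. ereal \<alpha> * phi Y) X
    \<and> (\<forall>j i. A $ j $ i \<in> {0..1})"
proof (intro conjI allI)
  show "prox_Lambda \<alpha> x \<in> prox (\<lambda>t. ereal \<alpha> * Lambda t) x" for x
    using assms(1) by (rule prox_Lambda_mem_prox)
  show "A $ j $ i \<in> {0..1}" for j i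
    unfolding assms(2) using assms(1) by (rule prox_Lambda_mem_Icc)
  show "A \<in> prox (\<lambda>Y. ereal \<alpha> * phi Y) X"
    \<comment> \<open>Each entry of \<open>A\<close> minimises its own summand, so the sums compare
      term by term.\<close>
    unfolding mem_prox_iff prox_objective_eq_sum[OF assms(1)] assms(2)
    using prox_Lambda_mem_prox[OF assms(1)] unfolding mem_prox_iff
    by (intro allI sum_mono) blast
qed

end
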